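(* Let $R$ be a countable fadelian ring. If $R$ is not right Noetherian, then $R((X))$ is a fadelian ring which is not right Ore. Likewise, if $R$ is not left Noetherian, then $R((X))$ is a fadelian ring which is not left Ore.
   Context: All rings are nontrivial ($1\neq 0$), unital, associative, and not assumed commutative. A ring $R$ is fadelian if for every $x\in R$ and every nonzero $a\in R$ there exist $b,c\in R$ such that $x=ab+ca$. A ring is integral if it has no zero divisors ($xy=0$ implies $x=0$ or $y=0$); every fadelian ring is integral. An integral ring is right (resp. left) Ore if any two nonzero right (resp. left) ideals have a nonzero intersection. $R[[X]]$ is the ring of formal power series over $R$ in which the indeterminate $X$ commutes with the elements of $R$, i.e. $\left(\sum_{n\ge 0} a_nX^n\right)\left(\sum_{n\ge 0} b_nX^n\right)=\sum_{n\ge 0}\left(\sum_{i=0}^n a_ib_{n-i}\right)X^n$. $R((X))$ is the ring of formal Laurent series: its elements are $0$ and the elements $X^jP$ with $j\in\mathbb{Z}$, $P\in R[[X]]$ with nonzero constant coefficient, with product $(X^jP)(X^kQ)=X^{j+k}(PQ)$ and the usual addition. *)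

theory Defs
  imports
    "HOL-Library.Countable_Set"
    "HOL-Computational_Algebra.Formal_Laurent_Series"
begin

text \<open>
  A nontrivial, unital, associative, not necessarily commutative ring is a type of class
  \<^class>\<open>ring_1\<close> (which includes \<open>0 \<noteq> 1\<close>); properties of the ring as a whole are predicates on
  \<open>TYPE('a)\<close>. For such an \<open>'a\<close>, the ring of formal Laurent series in a central indeterminate is
  \<open>'a fls\<close>: its product multiplies the base factors \<open>P\<close>, \<open>Q\<close> of \<open>X^j P\<close>, \<open>X^k Q\<close> as power series,
  keeping the order of the coefficients, and shifts the result by \<open>j + k\<close>.
\<close>

definition fadelian :: "'a::ring_1 itself \<Rightarrow> bool" where
  "fadelian _ \<longleftrightarrow> (\<forall>(x::'a) a. a \<noteq> 0 \<longrightarrow> (\<exists>b c. x = a * b + c * a))"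

definition integral_ring :: "'a::ring_1 itself \<Rightarrow> bool" where
  "integral_ring _ \<longleftrightarrow> (\<forall>(x::'a) y. x * y = 0 \<longrightarrow> x = 0 \<or> y = 0)"

text \<open>Closure under negation is the case \<open>r = - 1\<close> of closure under multiplication.\<close>

definition right_ideal :: "'a::ring_1 set \<Rightarrow> bool" where
  "right_ideal I \<longleftrightarrow>
     0 \<in> I \<and> (\<forall>x\<in>I. \<forall>y\<in>I. x + y \<in> I) \<and> (\<forall>x\<in>I. \<forall>r. x * r \<in> I)"

definition left_ideal :: "'a::ring_1 set \<Rightarrow> bool" where
  "left_ideal I \<longleftrightarrow>
     0 \<in> I \<and> (\<forall>x\<in>I. \<forall>y\<in>I. x + y \<in> I) \<and> (\<forall>x\<in>I. \<forall>r. r * x \<in> I)"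

definition right_noetherian :: "'a::ring_1 itself \<Rightarrow> bool" where
  "right_noetherian _ \<longleftrightarrow>
     (\<forall>I :: nat \<Rightarrow> 'a set. (\<forall>n. right_ideal (I n)) \<longrightarrow> incseq I \<longrightarrow> (\<exists>N. \<forall>n\<ge>N. I n = I N))"

definition left_noetherian :: "'a::ring_1 itself \<Rightarrow> bool" where
  "left_noetherian _ \<longleftrightarrow>
     (\<forall>I :: nat \<Rightarrow> 'a set. (\<forall>n. left_ideal (I n)) \<longrightarrow> incseq I \<longrightarrow> (\<exists>N. \<forall>n\<ge>N. I n = I N))"

text \<open>
  The Ore conditions are meant for integral rings. Integrality is not made part of the
  definitions, so that their negations assert the failure of the intersection property itself;
  by \<open>fadelian_imp_integral_ring\<close> below it is automatic for fadelian rings.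
\<close>

definition right_ore :: "'a::ring_1 itself \<Rightarrow> bool" where
  "right_ore _ \<longleftrightarrow>
     (\<forall>I J :: 'a set. right_ideal I \<longrightarrow> right_ideal J \<longrightarrow> I \<noteq> {0} \<longrightarrow> J \<noteq> {0} \<longrightarrow> I \<inter> J \<noteq> {0})"

definition left_ore :: "'a::ring_1 itself \<Rightarrow> bool" where
  "left_ore _ \<longleftrightarrow>
     (\<forall>I J :: 'a set. left_ideal I \<longrightarrow> left_ideal J \<longrightarrow> I \<noteq> {0} \<longrightarrow> J \<noteq> {0} \<longrightarrow> I \<inter> J \<noteq> {0})"

lemma fadelian_imp_integral_ring:
  assumes "fadelian TYPE('a::ring_1)"
  shows "integral_ring TYPE('a)"
proof -
  have dec: "\<exists>b c. x = a * b + c * a" if "a \<noteq> 0" for x a :: 'a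
    using assms that unfolding fadelian_def by blast
  have reduced: "a = 0" if sq: "a * a = 0" for a :: 'a
  proof (rule ccontr)
    assume "a \<noteq> 0"
    have sandwich: "a * x * a = 0" for x
    proof -
      obtain b c where "x = a * b + c * a" using dec[OF \<open>a \<noteq> 0\<close>] by blast
      then have "a * x * a = (a * a) * b * a + a * c * (a * a)"
        by (simp add: algebra_simps)
      then show ?thesis by (simp add: sq)
    qed
    obtain b c where "1 = a * b + c * a" using dec[OF \<open>a \<noteq> 0\<close>] by blast
    then have "a = a * (a * b + c * a)" by simp
    also have "\<dots> = (a * a) * b + a * c * a" by (simp add: algebra_simps)
    also have "\<dots> = 0" by (simp add: sq sandwich)
    finally show False using \<open>a \<noteq> 0\<close> by simp
  qed
  have "y = 0" if xy: "x * y = 0" and "x \<noteq> 0" for x y :: 'a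
  proof -
    have yrx: "y * r * x = 0" for r
    proof (rule reduced)
      have "(y * r * x) * (y * r * x) = y * r * (x * y) * r * x" by (simp add: mult.assoc)
      then show "(y * r * x) * (y * r * x) = 0" by (simp add: xy)
    qed
    obtain b c where "1 = x * b + c * x" using dec[OF \<open>x \<noteq> 0\<close>] by blast
    then have "y = y * (x * b + c * x)" by simp
    also have "\<dots> = (y * 1 * x) * b + y * c * x" by (simp add: algebra_simps)
    also have "\<dots> = 0" by (simp only: yrx mult_zero_left add_0_left)
    finally show ?thesis .
  qed
  then show ?thesis unfolding integral_ring_def by blast
qed

end

theory Submission
  imports Defs
begin

text \<open>
  \<open>R((X))\<close> is fadelian because \<open>R\<close> is (\<open>fps_fadelian_equation\<close>): after multiplication by powers of the central
  unit \<open>X\<close>, the equation \<open>x = a b + c a\<close> is one between power series with \<open>a\<^sub>0 \<noteq> 0\<close>, and comparing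
  coefficients of \<open>X\<^sup>n\<close> leaves \<open>a\<^sub>0 b\<^sub>n + c\<^sub>n a\<^sub>0 = (known terms)\<close>, which is solvable in \<open>R\<close>.

  The Ore condition is defeated by diagonalization (\<open>escaping_sequence\<close>). Let the right ideals
  \<open>I\<^sub>0 \<subseteq> I\<^sub>1 \<subseteq> \<dots>\<close> form a chain that does not stabilize, with union \<open>I\<close>. For no \<open>u \<noteq> 0\<close> and no \<open>k\<close> is
  \<open>I u \<subseteq> I\<^sub>k\<close>: writing \<open>1 = u b + c u\<close>, every \<open>y \<in> I\<close> is \<open>y = (y u) b + (y c) u\<close>, where \<open>y\<close> and
  \<open>y c\<close> lie in \<open>I\<close>, so that \<open>I \<subseteq> I\<^sub>k\<close> would follow. As \<open>R\<close> is countable, its nonzero elements can be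
  enumerated as \<open>e\<^sub>0, e\<^sub>1, \<dots>\<close>. Passing to a subsequence \<open>K\<close> of the chain with a nonzero \<open>b \<in> K\<^sub>0\<close>, one
  can choose \<open>a\<^sub>n \<in> K\<^sub>n\<^sub>+\<^sub>1\<close> such that \<open>a\<^sub>n e\<^sub>n \<notin> K\<^sub>n\<close>.

  Put \<open>A = \<Sum> a\<^sub>n X\<^sup>n\<close>. If \<open>A U = b V\<close> with \<open>U \<noteq> 0\<close>, let \<open>e\<^sub>n\<close> be the leading coefficient of \<open>U\<close>,
  in degree \<open>d\<close>. In degree \<open>d + n\<close> the equation expresses \<open>a\<^sub>n e\<^sub>n\<close> as a right combination of
  \<open>b, a\<^sub>0, \<dots>, a\<^sub>n\<^sub>-\<^sub>1\<close>, all of which lie in \<open>K\<^sub>n\<close>, a contradiction. So the right ideals generated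
  by \<open>A\<close> and by \<open>b\<close> meet in zero only. The left-hand case is the mirror image.
\<close>

unbundle Formal_Power_Series.fps_syntax and Formal_Laurent_Series.fps_syntax

section \<open>Laurent series over a fadelian ring\<close>

text \<open>
  The recursion on coefficients: since \<open>a\<^sub>0 \<noteq> 0\<close>, the coefficients \<open>b\<^sub>n\<close> and \<open>c\<^sub>n\<close> can be found once all
  earlier ones are known.
\<close>

lemma fps_fadelian_equation:
  fixes p q :: "'a::ring_1 fps"
  assumes fad: "fadelian TYPE('a)" and p0: "p $ 0 \<noteq> 0"
  shows "\<exists>f g. q = p * f + g * p"
proof -
  define P :: "(nat \<Rightarrow> 'a \<times> 'a) \<Rightarrow> nat \<Rightarrow> 'a \<times> 'a \<Rightarrow> bool" where
    "P h n r \<longleftrightarrow> q $ n = p $ 0 * fst r + snd r * p $ 0 +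
       ((\<Sum>i<n. p $ (n - i) * fst (h i)) + (\<Sum>i<n. snd (h i) * p $ (n - i)))" for h n r
  have "\<exists>h. \<forall>n. P h n (h n)"
  proof (rule dependent_wellorder_choice)
    show "P h n r = P k n r" if "\<And>i. i < n \<Longrightarrow> h i = k i" for r h k n
      using that by (simp add: P_def)
    show "\<exists>r. P h n r" for n h
    proof -
      obtain b c where "q $ n - ((\<Sum>i<n. p $ (n - i) * fst (h i)) + (\<Sum>i<n. snd (h i) * p $ (n - i)))
          = p $ 0 * b + c * p $ 0"
        using fad p0 unfolding fadelian_def by blast
      then have "P h n (b, c)"
        by (simp add: P_def algebra_simps)
      then show ?thesis ..
    qed
  qed
  then obtain h where h: "P h n (h n)" for n by blast
  define f g where "f = Abs_fps (\<lambda>n. fst (h n))" and "g = Abs_fps (\<lambda>n. snd (h n))"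
  have "q = p * f + g * p"
  proof (rule fps_ext)
    fix n
    have "(p * f) $ n = (\<Sum>i\<in>{0..n}. p $ (n - i) * fst (h i))"
      unfolding fps_mult_nth f_def by (subst sum.atLeastAtMost_rev) simp
    moreover have "(g * p) $ n = (\<Sum>i\<in>{0..n}. snd (h i) * p $ (n - i))"
      by (simp add: fps_mult_nth g_def)
    moreover have "{0..n} = insert n {..<n}" by auto
    ultimately show "q $ n = (p * f + g * p) $ n"
      using h[of n] by (simp add: P_def algebra_simps)
  qed
  then show ?thesis by blast
qed

lemma fadelian_fls:
  assumes "fadelian TYPE('a::ring_1)"
  shows "fadelian TYPE('a fls)"
  unfolding fadelian_def
proof (intro allI impI)
  fix x a :: "'a fls"
  assume "a \<noteq> 0"
  define p q where "p = fls_base_factor_to_fps a" and "q = fls_base_factor_to_fps x"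
  define d k where "d = fls_subdegree a" and "k = fls_subdegree x"
  have a: "a = fls_shift (- d) (fps_to_fls p)" and x: "x = fls_shift (- k) (fps_to_fls q)"
    unfolding p_def q_def d_def k_def by (rule fls_conv_base_factor_to_fps_shift_subdegree)+
  have "p $ 0 \<noteq> 0"
    using \<open>a \<noteq> 0\<close> by (simp add: p_def)
  then obtain f g where "q = p * f + g * p"
    using fps_fadelian_equation[OF assms] by blast
  then have "x = a * fls_shift (d - k) (fps_to_fls f) + fls_shift (d - k) (fps_to_fls g) * a"
    by (simp add: x a fls_times_both_shifted_simp fls_times_fps_to_fls)
  then show "\<exists>b c. x = a * b + c * a" by blast
qed

section \<open>Diagonalization along a chain of ideals\<close>

text \<open>
  The diagonal sequence. It is stated for an arbitrary binary operation \<open>m\<close>, so that \<open>m x y = x * y\<close>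
  gives the version for right ideals and \<open>m x y = y * x\<close> the one for left ideals. The hypothesis
  \<open>split\<close> is what the fadelian property provides: \<open>1 = u b + c u\<close>, multiplied by \<open>y\<close>.
\<close>

lemma escaping_sequence:
  fixes m :: "'a::ring_1 \<Rightarrow> 'a \<Rightarrow> 'a" and I :: "nat \<Rightarrow> 'a set" and e :: "nat \<Rightarrow> 'a"
  assumes zero: "\<And>n. 0 \<in> I n"
    and add: "\<And>n x y. x \<in> I n \<Longrightarrow> y \<in> I n \<Longrightarrow> x + y \<in> I n"
    and mult: "\<And>n x r. x \<in> I n \<Longrightarrow> m x r \<in> I n"
    and inc: "incseq I" and unstable: "\<not> (\<exists>N. \<forall>n\<ge>N. I n = I N)"
    and split: "\<And>u. u \<noteq> 0 \<Longrightarrow> \<exists>b c. \<forall>y. y = m (m y u) b + m (m y c) u"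
    and e: "\<And>n. e n \<noteq> 0"
  obtains b K a where "b \<noteq> 0" "b \<in> K 0" "incseq K" "\<And>n. K n \<in> range I"
    "\<And>n. a n \<in> K (Suc n)" "\<And>n. m (a n) (e n) \<notin> K n"
proof -
  have not_absorbed: "\<not> (\<Union>n. I n) \<subseteq> I k" for k
  proof
    assume "(\<Union>n. I n) \<subseteq> I k"
    then have "\<forall>n\<ge>k. I n = I k"
      using inc by (auto simp: incseq_def)
    then show False using unstable by blast
  qed
  have escape: "\<exists>y l. k \<le> l \<and> y \<in> I l \<and> m y u \<notin> I k" if "u \<noteq> 0" for k u
  proof (rule ccontr)
    assume "\<not> ?thesis"
    then have absorb: "m y u \<in> I k" if "y \<in> I l" for y l
      using that inc by (meson incseqD max.cobounded1 max.cobounded2 subsetD)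
    obtain b c where bc: "\<And>y. y = m (m y u) b + m (m y c) u"
      using split[OF \<open>u \<noteq> 0\<close>] by blast
    have "y \<in> I k" if "y \<in> I l" for y l
      using bc[of y] add[OF mult[OF absorb[OF that]] absorb[OF mult[OF that]]] by metis
    then show False using not_absorbed[of k] by blast
  qed
  obtain b k0 where b: "b \<in> I k0" "b \<notin> I 0"
    using not_absorbed[of 0] by blast
  then have "b \<noteq> 0" using zero[of 0] by metis
  \<comment> \<open>The second component of \<open>f n\<close> is the index of \<open>K n\<close> in the chain. The first component of
    \<open>f (Suc n)\<close> is \<open>a n\<close>, chosen together with the index of an ideal that contains it; the first
    component of \<open>f 0\<close> is arbitrary.\<close>
  have "\<exists>f :: nat \<Rightarrow> 'a \<times> nat. \<forall>n. (n = 0 \<longrightarrow> snd (f n) = k0) \<and>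
      (snd (f n) \<le> snd (f (Suc n)) \<and> fst (f (Suc n)) \<in> I (snd (f (Suc n))) \<and>
       m (fst (f (Suc n))) (e n) \<notin> I (snd (f n)))"
  proof (rule dependent_nat_choice)
    show "\<exists>x :: 'a \<times> nat. 0 = (0::nat) \<longrightarrow> snd x = k0" by auto
    show "\<exists>y. (Suc n = 0 \<longrightarrow> snd y = k0) \<and>
        (snd x \<le> snd y \<and> fst y \<in> I (snd y) \<and> m (fst y) (e n) \<notin> I (snd x))"
      for x :: "'a \<times> nat" and n
      using escape[OF e[of n], of "snd x"] by fastforce
  qed
  then obtain f :: "nat \<Rightarrow> 'a \<times> nat" where f0: "snd (f 0) = k0"
    and f: "\<And>n. snd (f n) \<le> snd (f (Suc n))" "\<And>n. fst (f (Suc n)) \<in> I (snd (f (Suc n)))"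
      "\<And>n. m (fst (f (Suc n))) (e n) \<notin> I (snd (f n))"
    by blast
  have "incseq (\<lambda>n. I (snd (f n)))"
    using f(1) inc by (intro incseq_SucI) (auto dest: incseqD)
  with \<open>b \<noteq> 0\<close> b(1) f0 f show thesis
    by (intro that[of b "\<lambda>n. I (snd (f n))" "\<lambda>n. fst (f (Suc n))"]) auto
qed

section \<open>Failure of the Ore condition\<close>

text \<open>
  Counted from the lowest degree of \<open>u\<close>, the coefficients of the product are those of a product of
  power series; the term \<open>i = n\<close> is \<open>p\<^sub>n\<close> times the leading coefficient of \<open>u\<close>.
\<close>

lemma fps_times_fls_nth:
  fixes p :: "'a::ring_1 fps"
  shows "(fps_to_fls p * u) $$ (fls_subdegree u + int n) =
      (\<Sum>i\<le>n. p $ i * u $$ (fls_subdegree u + int (n - i)))" (is ?left)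
    and "(u * fps_to_fls p) $$ (fls_subdegree u + int n) =
      (\<Sum>i\<le>n. u $$ (fls_subdegree u + int (n - i)) * p $ i)" (is ?right)
proof -
  define w d where "w = fls_base_factor_to_fps u" and "d = fls_subdegree u"
  have u: "u = fls_shift (- d) (fps_to_fls w)"
    unfolding w_def d_def by (rule fls_conv_base_factor_to_fps_shift_subdegree)
  have w: "w $ n = u $$ (d + int n)" for n
    unfolding w_def d_def by (rule fls_base_factor_to_fps_nth)
  have "(fps_to_fls p * u) $$ (d + int n) = (p * w) $ n"
    by (simp add: u fls_shifted_times_simps flip: fls_times_fps_to_fls)
  then show ?left
    by (simp add: fps_mult_nth w d_def atLeast0AtMost)
  have "(u * fps_to_fls p) $$ (d + int n) = (w * p) $ n"
    by (simp add: u fls_shifted_times_simps flip: fls_times_fps_to_fls)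
  also have "\<dots> = (\<Sum>i\<in>{0..n}. w $ (n - i) * p $ i)"
    unfolding fps_mult_nth by (subst sum.atLeastAtMost_rev) simp
  finally show ?right
    by (simp add: w d_def atLeast0AtMost)
qed

lemma right_ideal_diff_sum:
  assumes "right_ideal J" "x \<in> J" "\<And>i. i \<in> S \<Longrightarrow> g i \<in> J"
  shows "x - sum g S \<in> J"
proof -
  have "sum g S \<in> J"
    using assms by (induction S rule: infinite_finite_induct) (auto simp: right_ideal_def)
  then have "x + sum g S * (- 1) \<in> J"
    using assms(1,2) unfolding right_ideal_def by blast
  then show ?thesis by simp
qed

lemma left_ideal_diff_sum:
  assumes "left_ideal J" "x \<in> J" "\<And>i. i \<in> S \<Longrightarrow> g i \<in> J"
  shows "x - sum g S \<in> J"
proof -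
  have "sum g S \<in> J"
    using assms by (induction S rule: infinite_finite_induct) (auto simp: left_ideal_def)
  then have "x + (- 1) * sum g S \<in> J"
    using assms(1,2) unfolding left_ideal_def by blast
  then show ?thesis by simp
qed

lemma right_ideal_principal: "right_ideal (range ((*) a))" for a :: "'a::ring_1"
  unfolding right_ideal_def
proof (intro conjI ballI allI)
  show "0 \<in> range ((*) a)" by (metis mult_zero_right rangeI)
  show "x + y \<in> range ((*) a)" if "x \<in> range ((*) a)" "y \<in> range ((*) a)" for x y
    using that by (auto simp flip: distrib_left)
  show "x * r \<in> range ((*) a)" if "x \<in> range ((*) a)" for x r
    using that by (auto simp: mult.assoc)
qed

lemma left_ideal_principal: "left_ideal (range (\<lambda>x. x * a))" for a :: "'a::ring_1"
  unfolding left_ideal_def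
proof (intro conjI ballI allI)
  show "0 \<in> range (\<lambda>x. x * a)" by (metis mult_zero_left rangeI)
  show "x + y \<in> range (\<lambda>x. x * a)" if "x \<in> range (\<lambda>x. x * a)" "y \<in> range (\<lambda>x. x * a)" for x y
    using that by (auto simp flip: distrib_right)
  show "r * x \<in> range (\<lambda>x. x * a)" if "x \<in> range (\<lambda>x. x * a)" for x r
    using that by (auto simp flip: mult.assoc)
qed

text \<open>
  The two ideals that witness the failure are those generated by \<open>\<Sum> a\<^sub>n X\<^sup>n\<close> and by the constant \<open>b\<close>.
  The hypothesis \<open>surj\<close> makes the leading coefficient of any multiplier occur as some \<open>e\<^sub>n\<close>.
\<close>

lemma not_right_ore_fls_if_escaping:
  fixes a e :: "nat \<Rightarrow> 'a::ring_1" and K :: "nat \<Rightarrow> 'a set"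
  assumes b: "b \<noteq> 0" "b \<in> K 0" and K: "incseq K" "\<And>n. right_ideal (K n)"
    and a: "\<And>n. a n \<in> K (Suc n)" "\<And>n. a n * e n \<notin> K n"
    and surj: "\<And>u. u \<noteq> 0 \<Longrightarrow> \<exists>n. e n = u"
  shows "\<not> right_ore TYPE('a fls)"
proof
  assume ore: "right_ore TYPE('a fls)"
  define A B where "A = fps_to_fls (Abs_fps a)" and "B = fls_const b"
  have "a 0 \<noteq> 0"
    using a(2)[of 0] K(2)[of 0] by (auto simp: right_ideal_def)
  then have "A $$ 0 \<noteq> 0" by (simp add: A_def)
  then have "A \<noteq> 0" by auto
  moreover have "B \<noteq> 0" using b(1) by (simp add: B_def)
  ultimately have "range ((*) A) \<noteq> {0}" "range ((*) B) \<noteq> {0}"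
    by (metis mult.right_neutral rangeI singletonD)+
  then have "range ((*) A) \<inter> range ((*) B) \<noteq> {0}"
    using ore right_ideal_principal unfolding right_ore_def by blast
  moreover have "0 \<in> range ((*) A) \<inter> range ((*) B)"
    using right_ideal_principal by (auto simp: right_ideal_def)
  ultimately obtain U V where UV: "A * U = B * V" "A * U \<noteq> 0" by blast
  define d where "d = fls_subdegree U"
  have "U \<noteq> 0" using UV(2) by auto
  then have "U $$ d \<noteq> 0" unfolding d_def by (rule nth_fls_subdegree_nonzero)
  then obtain n where n: "e n = U $$ d" using surj by metis
  \<comment> \<open>In degree \<open>d + n\<close> the coefficient \<open>a n\<close> of \<open>A\<close> meets the leading coefficient \<open>e n\<close> of \<open>U\<close>.\<close>
  have "b * V $$ (d + int n) = (\<Sum>i\<le>n. a i * U $$ (d + int (n - i)))"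
    using arg_cong[OF UV(1), of "\<lambda>W. W $$ (d + int n)"] fps_times_fls_nth(1)[of "Abs_fps a" U n]
    by (simp add: A_def B_def d_def)
  then have "a n * e n = b * V $$ (d + int n) - (\<Sum>i<n. a i * U $$ (d + int (n - i)))"
    by (simp add: n flip: lessThan_Suc_atMost)
  also have "\<dots> \<in> K n"
  proof (rule right_ideal_diff_sum[OF K(2)])
    show "b * V $$ (d + int n) \<in> K n"
      using b(2) K incseqD[OF K(1), of 0 n] unfolding right_ideal_def by blast
    show "a i * U $$ (d + int (n - i)) \<in> K n" if "i \<in> {..<n}" for i
      using that a(1)[of i] K(2)[of n] incseqD[OF K(1), of "Suc i" n] unfolding right_ideal_def
      by (auto simp: Suc_le_eq)
  qed
  finally show False using a(2) by blast
qed

lemma not_left_ore_fls_if_escaping: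
  fixes a e :: "nat \<Rightarrow> 'a::ring_1" and K :: "nat \<Rightarrow> 'a set"
  assumes b: "b \<noteq> 0" "b \<in> K 0" and K: "incseq K" "\<And>n. left_ideal (K n)"
    and a: "\<And>n. a n \<in> K (Suc n)" "\<And>n. e n * a n \<notin> K n"
    and surj: "\<And>u. u \<noteq> 0 \<Longrightarrow> \<exists>n. e n = u"
  shows "\<not> left_ore TYPE('a fls)"
proof
  assume ore: "left_ore TYPE('a fls)"
  define A B where "A = fps_to_fls (Abs_fps a)" and "B = fls_const b"
  have "a 0 \<noteq> 0"
    using a(2)[of 0] K(2)[of 0] by (auto simp: left_ideal_def)
  then have "A $$ 0 \<noteq> 0" by (simp add: A_def)
  then have "A \<noteq> 0" by auto
  moreover have "B \<noteq> 0" using b(1) by (simp add: B_def)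
  ultimately have "range (\<lambda>x. x * A) \<noteq> {0}" "range (\<lambda>x. x * B) \<noteq> {0}"
    by (metis mult.left_neutral rangeI singletonD)+
  then have "range (\<lambda>x. x * A) \<inter> range (\<lambda>x. x * B) \<noteq> {0}"
    using ore left_ideal_principal unfolding left_ore_def by blast
  moreover have "0 \<in> range (\<lambda>x. x * A) \<inter> range (\<lambda>x. x * B)"
    using left_ideal_principal by (auto simp: left_ideal_def)
  ultimately obtain U V where UV: "U * A = V * B" "U * A \<noteq> 0" by blast
  define d where "d = fls_subdegree U"
  have "U \<noteq> 0" using UV(2) by auto
  then have "U $$ d \<noteq> 0" unfolding d_def by (rule nth_fls_subdegree_nonzero)
  then obtain n where n: "e n = U $$ d" using surj by metis
  have "V $$ (d + int n) * b = (\<Sum>i\<le>n. U $$ (d + int (n - i)) * a i)"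
    using arg_cong[OF UV(1), of "\<lambda>W. W $$ (d + int n)"] fps_times_fls_nth(2)[of U "Abs_fps a" n]
    by (simp add: A_def B_def d_def)
  then have "e n * a n = V $$ (d + int n) * b - (\<Sum>i<n. U $$ (d + int (n - i)) * a i)"
    by (simp add: n flip: lessThan_Suc_atMost)
  also have "\<dots> \<in> K n"
  proof (rule left_ideal_diff_sum[OF K(2)])
    show "V $$ (d + int n) * b \<in> K n"
      using b(2) K incseqD[OF K(1), of 0 n] unfolding left_ideal_def by blast
    show "U $$ (d + int (n - i)) * a i \<in> K n" if "i \<in> {..<n}" for i
      using that a(1)[of i] K(2)[of n] incseqD[OF K(1), of "Suc i" n] unfolding left_ideal_def
      by (auto simp: Suc_le_eq)
  qed
  finally show False using a(2) by blast
qed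

theorem theorem4:
  assumes "countable (UNIV :: 'a::ring_1 set)"
    and "fadelian TYPE('a)"
  shows "(\<not> right_noetherian TYPE('a) \<longrightarrow>
            fadelian TYPE('a fls) \<and> \<not> right_ore TYPE('a fls)) \<and>
         (\<not> left_noetherian TYPE('a) \<longrightarrow>
            fadelian TYPE('a fls) \<and> \<not> left_ore TYPE('a fls))"
proof -
  define e where "e = from_nat_into (UNIV - {0 :: 'a})"
  have "1 \<in> UNIV - {0 :: 'a}" by simp
  then have "UNIV - {0 :: 'a} \<noteq> {}" by blast
  moreover have "countable (UNIV - {0 :: 'a})"
    using assms(1) by (rule countable_Diff)
  ultimately have range_e: "range e = UNIV - {0}"
    unfolding e_def by (rule range_from_nat_into)
  have e: "e n \<noteq> 0" for n
    using rangeI[of e n] unfolding range_e by simp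
  have surj: "\<exists>n. e n = u" if "u \<noteq> 0" for u
  proof -
    have "u \<in> range e" unfolding range_e using that by simp
    then show ?thesis by auto
  qed
  have one: "\<exists>b c. 1 = u * b + c * u" if "u \<noteq> 0" for u :: 'a
    using assms(2) that unfolding fadelian_def by blast
  have "\<not> right_ore TYPE('a fls)" if nonnoeth: "\<not> right_noetherian TYPE('a)"
  proof -
    obtain I :: "nat \<Rightarrow> 'a set" where I: "\<And>n. right_ideal (I n)" "incseq I"
      "\<not> (\<exists>N. \<forall>n\<ge>N. I n = I N)"
      using nonnoeth unfolding right_noetherian_def by blast
    have split: "\<exists>b c. \<forall>y. y = y * u * b + y * c * u" if u: "u \<noteq> 0" for u :: 'a
    proof -
      obtain b c where "1 = u * b + c * u" using one[OF u] by blast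
      then have "y = y * u * b + y * c * u" for y
        by (metis distrib_left mult.assoc mult.right_neutral)
      then show ?thesis by blast
    qed
    have closed: "0 \<in> I n" "x \<in> I n \<Longrightarrow> y \<in> I n \<Longrightarrow> x + y \<in> I n"
        "x \<in> I n \<Longrightarrow> x * r \<in> I n" for n x y r
      using I(1)[of n] by (auto simp: right_ideal_def)
    obtain b K a where K: "b \<noteq> 0" "b \<in> K 0" "incseq K" "\<And>n. K n \<in> range I"
      "\<And>n. a n \<in> K (Suc n)" "\<And>n. a n * e n \<notin> K n"
      by (rule escaping_sequence[where m = "(*)" and I = I and e = e, OF closed I(2,3) split e];
          (assumption | rule that; assumption))
    have "right_ideal (K n)" for n
      using K(4)[of n] I(1) by auto
    then show ?thesis
      by (rule not_right_ore_fls_if_escaping[OF K(1-3) _ K(5,6) surj])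
  qed
  moreover have "\<not> left_ore TYPE('a fls)" if nonnoeth: "\<not> left_noetherian TYPE('a)"
  proof -
    obtain I :: "nat \<Rightarrow> 'a set" where I: "\<And>n. left_ideal (I n)" "incseq I"
      "\<not> (\<exists>N. \<forall>n\<ge>N. I n = I N)"
      using nonnoeth unfolding left_noetherian_def by blast
    have split: "\<exists>b c. \<forall>y. y = b * (u * y) + u * (c * y)" if u: "u \<noteq> 0" for u :: 'a
    proof -
      obtain c b where "1 = u * c + b * u" using one[OF u] by blast
      then have "y = b * (u * y) + u * (c * y)" for y
        by (metis add.commute distrib_right mult.assoc mult.left_neutral)
      then show ?thesis by blast
    qed
    have closed: "0 \<in> I n" "x \<in> I n \<Longrightarrow> y \<in> I n \<Longrightarrow> x + y \<in> I n"
        "x \<in> I n \<Longrightarrow> r * x \<in> I n" for n x y r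
      using I(1)[of n] by (auto simp: left_ideal_def)
    obtain b K a where K: "b \<noteq> 0" "b \<in> K 0" "incseq K" "\<And>n. K n \<in> range I"
      "\<And>n. a n \<in> K (Suc n)" "\<And>n. e n * a n \<notin> K n"
      by (rule escaping_sequence[where m = "\<lambda>x y. y * x" and I = I and e = e, OF closed I(2,3) split e];
          (assumption | rule that; assumption))
    have "left_ideal (K n)" for n
      using K(4)[of n] I(1) by auto
    then show ?thesis
      by (rule not_left_ore_fls_if_escaping[OF K(1-3) _ K(5,6) surj])
  qed
  ultimately show ?thesis
    using fadelian_fls[OF assms(2)] by blast
qed

end
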